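(* Let $N\ge2$, let $\omega_1,\ldots,\omega_{N-1}$ be the interior Legendre-Gauss-Lobatto weights, $\mathbf W=\operatorname{diag}(\omega_1,\ldots,\omega_{N-1})$, and let $\mathbf C=\operatorname{diag}(c_1,\ldots,c_{N-1})$ with all $c_i>0$. Let $\mathbf D^{(2)}$ be the interior second-order differentiation matrix and $\mathbf B$ the Birkhoff integration matrix at the LGL nodes. Define $$\mathbf B_c:=\mathbf C^{-\frac12}\mathbf B\,\mathbf C^{-\frac12},\qquad \mathbf S_c:=\mathbf W^{\frac12}\mathbf B_c\mathbf W^{-\frac12}.$$ Then $\mathbf S_c$ is symmetric negative definite, and so admits an orthogonal diagonalisation $$\mathbf S_c=\mathbf Q_c\mathbf\Sigma_c\mathbf Q_c^{\intercal},\qquad \mathbf Q_c^{\intercal}\mathbf Q_c=\mathbf I_{N-1},\qquad \mathbf\Sigma_c=\operatorname{diag}(\sigma_{c,1},\ldots,\sigma_{c,N-1}),$$ and for any such diagonalisation, $$\mathbf B\mathbf C^{-1}=\mathbf V_c\mathbf\Sigma_c\mathbf V_c^{-1},\qquad \mathbf C\mathbf D^{(2)}=\mathbf V_c\mathbf\Sigma_c^{-1}\mathbf V_c^{-1},$$ where $$\mathbf V_c=\mathbf C^{\frac12}\mathbf W^{-\frac12}\mathbf Q_c,\qquad \mathbf V_c^{-1}=\mathbf Q_c^{\intercal}\mathbf W^{\frac12}\mathbf C^{-\frac12}.$$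
   Context: $\mathbb P_N$ is the space of real polynomials of degree at most $N$. The Legendre-Gauss-Lobatto (LGL) nodes $-1=x_0<x_1<\cdots<x_N=1$ are the zeros of $(1-x^2)L_N'(x)$ ($L_N$ the Legendre polynomial of degree $N$), with positive weights $\omega_j$ such that $\int_{-1}^1\phi(x)\,dx=\sum_{j=0}^N\phi(x_j)\omega_j$ for all $\phi\in\mathbb P_{2N-1}$. Let $\ell_j\in\mathbb P_N$, $0\le j\le N$, be the Lagrange basis polynomials, $\ell_j(x_i)=\delta_{ij}$, and $\mathbf D^{(2)}=(\ell_j''(x_i))_{1\le i,j\le N-1}$. For $1\le j\le N-1$, $B_j\in\mathbb P_N$ is the unique polynomial with $B_j(\pm1)=0$ and $B_j''(x_i)=\delta_{ij}$ for $1\le i\le N-1$; $\mathbf B=(B_j(x_i))_{1\le i,j\le N-1}$. It is known that $\mathbf D^{(2)}\mathbf B=\mathbf B\mathbf D^{(2)}=\mathbf I_{N-1}$. Powers of positive diagonal matrices are taken entrywise on the diagonal. *)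

theory Defs
  imports
    "HOL-Analysis.Analysis"
    "Jordan_Normal_Form.Matrix"
begin

unbundle no inner_syntax and no vec_syntax

text \<open>Rodrigues' formula, with the normalisation \<open>L\<^sub>n(1) = 1\<close>.\<close>

definition legendre :: "nat \<Rightarrow> real poly" where
  "legendre n = Polynomial.smult (1 / (2 ^ n * fact n)) ((pderiv ^^ n) ([:-1, 0, 1:] ^ n))"

definition lgl_nodes :: "nat \<Rightarrow> (nat \<Rightarrow> real) \<Rightarrow> bool" where
  "lgl_nodes N x \<longleftrightarrow>
     x 0 = -1 \<and> x N = 1 \<and> strict_mono_on {0..N} x \<and>
     x ` {0..N} = {t. poly ([:1, 0, -1:] * pderiv (legendre N)) t = 0}"

definition lgl_weights :: "nat \<Rightarrow> (nat \<Rightarrow> real) \<Rightarrow> (nat \<Rightarrow> real) \<Rightarrow> bool" where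
  "lgl_weights N x \<omega> \<longleftrightarrow>
     (\<forall>j\<in>{0..N}. \<omega> j > 0) \<and>
     (\<forall>p :: real poly. degree p \<le> 2 * N - 1 \<longrightarrow>
        integral {-1..1} (poly p) = (\<Sum>j=0..N. poly p (x j) * \<omega> j))"

text \<open>For pairwise distinct nodes the following descriptions determine a unique polynomial
  (\<open>lagrange_poly\<close> for \<open>0 \<le> j \<le> N\<close>, \<open>birkhoff_poly\<close> for \<open>1 \<le> j \<le> N - 1\<close>).\<close>

definition lagrange_poly :: "nat \<Rightarrow> (nat \<Rightarrow> real) \<Rightarrow> nat \<Rightarrow> real poly" where
  "lagrange_poly N x j = (THE p. degree p \<le> N \<and>
     (\<forall>i\<in>{0..N}. poly p (x i) = (if i = j then 1 else 0)))"

definition birkhoff_poly :: "nat \<Rightarrow> (nat \<Rightarrow> real) \<Rightarrow> nat \<Rightarrow> real poly" where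
  "birkhoff_poly N x j = (THE p. degree p \<le> N \<and> poly p (-1) = 0 \<and> poly p 1 = 0 \<and>
     (\<forall>i\<in>{1..N-1}. poly (pderiv (pderiv p)) (x i) = (if i = j then 1 else 0)))"

text \<open>Matrix indices start at 0, so entry \<open>(i, j)\<close> belongs to the interior
  indices \<open>i + 1\<close> and \<open>j + 1\<close>.\<close>

definition interior_mat :: "nat \<Rightarrow> (nat \<Rightarrow> nat \<Rightarrow> real) \<Rightarrow> real mat" where
  "interior_mat N a = Matrix.mat (N - 1) (N - 1) (\<lambda>(i, j). a (i + 1) (j + 1))"

definition interior_diag :: "nat \<Rightarrow> (nat \<Rightarrow> real) \<Rightarrow> real mat" where
  "interior_diag N d = mat_diag (N - 1) (\<lambda>i. d (i + 1))"

definition diff_mat2 :: "nat \<Rightarrow> (nat \<Rightarrow> real) \<Rightarrow> real mat" where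
  "diff_mat2 N x =
     interior_mat N (\<lambda>i j. poly (pderiv (pderiv (lagrange_poly N x j))) (x i))"

definition birkhoff_mat :: "nat \<Rightarrow> (nat \<Rightarrow> real) \<Rightarrow> real mat" where
  "birkhoff_mat N x = interior_mat N (\<lambda>i j. poly (birkhoff_poly N x j) (x i))"

text \<open>Powers of positive diagonal matrices, entrywise on the diagonal; off-diagonal entries
  of the argument are ignored.\<close>

definition diag_powr :: "real mat \<Rightarrow> real \<Rightarrow> real mat" where
  "diag_powr A r = mat_diag (dim_row A) (\<lambda>i. (A $$ (i, i)) powr r)"

definition mat_inv :: "real mat \<Rightarrow> real mat" where
  "mat_inv A = (THE B. inverts_mat A B \<and> inverts_mat B A)"

definition symmetric_negative_definite :: "real mat \<Rightarrow> bool" where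
  "symmetric_negative_definite A \<longleftrightarrow>
     square_mat A \<and> transpose_mat A = A \<and>
     (\<forall>v \<in> carrier_vec (dim_row A). v \<noteq> 0\<^sub>v (dim_row A) \<longrightarrow> v \<bullet> (A *\<^sub>v v) < 0)"

definition orthogonal_diagonalisation :: "real mat \<Rightarrow> real mat \<Rightarrow> real mat \<Rightarrow> bool" where
  "orthogonal_diagonalisation S Q D \<longleftrightarrow>
     Q \<in> carrier_mat (dim_row S) (dim_row S) \<and>
     D \<in> carrier_mat (dim_row S) (dim_row S) \<and> diagonal_mat D \<and>
     transpose_mat Q * Q = 1\<^sub>m (dim_row S) \<and>
     S = Q * D * transpose_mat Q"

end

theory Submission
  imports Defs "Jordan_Normal_Form.Char_Poly"
begin

text \<open>
  For \<open>p, q \<in> P\<^sub>N\<close> with \<open>p(\<plusminus>1) = 0\<close> the product \<open>p q''\<close> has degree at most \<open>2N - 2\<close>, so the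
  quadrature is exact on it and integration by parts gives
  \<open>(\<Sum>i. \<omega>\<^sub>i p(x\<^sub>i) q''(x\<^sub>i)) = - (\<integral> p' q')\<close>, summed over the interior nodes. Taking Birkhoff
  polynomials for \<open>p\<close> and \<open>q\<close> shows that \<open>W B\<close> is symmetric, and taking \<open>p = q\<close> that it is negative
  definite; \<open>S\<^sub>c\<close> is congruent to \<open>W B\<close> through the positive diagonal matrix
  \<open>C\<^sup>-\<^sup>1\<^sup>/\<^sup>2 W\<^sup>-\<^sup>1\<^sup>/\<^sup>2\<close>. With \<open>Y = C\<^sup>1\<^sup>/\<^sup>2 W\<^sup>-\<^sup>1\<^sup>/\<^sup>2\<close> one also has \<open>S\<^sub>c = Y\<^sup>-\<^sup>1 (B C\<^sup>-\<^sup>1) Y\<close>, which transports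
  every orthogonal diagonalisation of \<open>S\<^sub>c\<close> to \<open>B C\<^sup>-\<^sup>1\<close> and, by \<open>D\<^sup>(\<^sup>2\<^sup>) B = I\<close>, to its inverse \<open>C D\<^sup>(\<^sup>2\<^sup>)\<close>.
\<close>

section \<open>The spectral theorem for real symmetric matrices\<close>

lemma symmetric_mat_bilinear:
  fixes A :: "'a :: comm_semiring_0 mat"
  assumes "A \<in> carrier_mat n n" "transpose_mat A = A" "a \<in> carrier_vec n" "b \<in> carrier_vec n"
  shows "a \<bullet> (A *\<^sub>v b) = b \<bullet> (A *\<^sub>v a)"
proof -
  have "a \<bullet> (A *\<^sub>v b) = (A *\<^sub>v a) \<bullet> b"
    using transpose_vec_mult_scalar[OF assms(1,4,3)] assms(2) by simp
  also have "\<dots> = b \<bullet> (A *\<^sub>v a)"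
    using assms by (intro comm_scalar_prod[of _ n]) auto
  finally show ?thesis .
qed

lemma scalar_prod_self_eq_0_iff:
  fixes v :: "'a :: linordered_idom vec"
  assumes "v \<in> carrier_vec n"
  shows "v \<bullet> v = 0 \<longleftrightarrow> v = 0\<^sub>v n"
  using assms by (auto simp: scalar_prod_def sum_nonneg_eq_0_iff intro!: eq_vecI)

lemma scalar_prod_self_nonneg:
  fixes v :: "'a :: linordered_idom vec"
  shows "v \<bullet> v \<ge> 0"
  by (auto simp: scalar_prod_def intro!: sum_nonneg)

text \<open>The fundamental theorem of algebra gives a complex eigenvector
  \<open>u = a + i b\<close>. Evaluating
  \<open>a \<bullet> (A *\<^sub>v b) = b \<bullet> (A *\<^sub>v a)\<close> through its real and
  imaginary parts forces a real eigenvalue, and whichever of \<open>a\<close>, \<open>b\<close> is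
  nonzero is a real eigenvector.\<close>

lemma symmetric_mat_has_real_eigenvector:
  fixes A :: "real mat"
  assumes A: "A \<in> carrier_mat n n" and sym: "transpose_mat A = A" and "n > 0"
  obtains v k where "v \<in> carrier_vec n" "v \<noteq> 0\<^sub>v n" "A *\<^sub>v v = k \<cdot>\<^sub>v v"
proof -
  define Ac where "Ac = map_mat complex_of_real A"
  have Ac: "Ac \<in> carrier_mat n n"
    using A by (simp add: Ac_def)
  have "degree (char_poly Ac) = n"
    using degree_monic_char_poly[OF Ac] by simp
  then have "\<not> constant (poly (char_poly Ac))"
    using \<open>n > 0\<close> by (simp add: constant_degree)
  then obtain z where "poly (char_poly Ac) z = 0"
    using fundamental_theorem_of_algebra by blast
  then obtain u where u: "u \<in> carrier_vec n" "u \<noteq> 0\<^sub>v n" "Ac *\<^sub>v u = z \<cdot>\<^sub>v u"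
    using eigenvalue_root_char_poly[OF Ac] Ac by (auto simp: eigenvalue_def eigenvector_def)
  define a b where "a = map_vec Re u" and "b = map_vec Im u"
  have ab: "a \<in> carrier_vec n" "b \<in> carrier_vec n"
    using u(1) by (simp_all add: a_def b_def)
  have comp: "(\<Sum>j<n. complex_of_real (A $$ (i, j)) * u $ j) = z * u $ i" if "i < n" for i
    using arg_cong[OF u(3), of "\<lambda>w. w $ i"] that A u(1)
    by (simp add: Ac_def scalar_prod_def atLeast0LessThan)
  \<comment> \<open>Real and imaginary part of the eigenvector equation; symmetry then forces \<open>Im z = 0\<close>.\<close>
  have Aa: "A *\<^sub>v a = Re z \<cdot>\<^sub>v a - Im z \<cdot>\<^sub>v b"
    using A u(1) arg_cong[OF comp, of _ Re]
    by (intro eq_vecI) (auto simp: a_def b_def scalar_prod_def atLeast0LessThan)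
  have Ab: "A *\<^sub>v b = Im z \<cdot>\<^sub>v a + Re z \<cdot>\<^sub>v b"
    using A u(1) arg_cong[OF comp, of _ Im]
    by (intro eq_vecI) (auto simp: a_def b_def scalar_prod_def atLeast0LessThan)
  have "a \<bullet> (A *\<^sub>v b) = b \<bullet> (A *\<^sub>v a)"
    by (rule symmetric_mat_bilinear[OF A sym ab])
  moreover have "a \<bullet> (A *\<^sub>v b) = Im z * (a \<bullet> a) + Re z * (a \<bullet> b)"
    unfolding Ab using ab by (simp add: scalar_prod_add_distrib[of _ n])
  moreover have "b \<bullet> (A *\<^sub>v a) = Re z * (a \<bullet> b) - Im z * (b \<bullet> b)"
    unfolding Aa using ab
    by (simp add: scalar_prod_minus_distrib[of _ n] comm_scalar_prod[of b n a])
  ultimately have "Im z * (a \<bullet> a + b \<bullet> b) = 0"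
    by (simp add: algebra_simps)
  moreover have nz: "a \<noteq> 0\<^sub>v n \<or> b \<noteq> 0\<^sub>v n"
  proof (rule ccontr)
    assume *: "\<not> ?thesis"
    have "u $ i = 0" if "i < n" for i
    proof -
      have "a $ i = 0" "b $ i = 0"
        using * that by simp_all
      then show ?thesis
        using that u(1) by (simp add: a_def b_def complex_eq_iff)
    qed
    then show False
      using u by (metis carrier_vecD eq_vecI index_zero_vec)
  qed
  then have "a \<bullet> a + b \<bullet> b \<noteq> 0"
    using scalar_prod_self_eq_0_iff[OF ab(1)] scalar_prod_self_eq_0_iff[OF ab(2)]
      scalar_prod_self_nonneg[of a] scalar_prod_self_nonneg[of b] by linarith
  ultimately have "Im z = 0"
    by simp
  then have "A *\<^sub>v a = Re z \<cdot>\<^sub>v a" "A *\<^sub>v b = Re z \<cdot>\<^sub>v b"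
    using Aa Ab ab by auto
  then show thesis
    using nz ab that by blast
qed

text \<open>The reflection whose mirror is orthogonal to the difference of \<open>v\<close> and the
  first unit vector swaps these two vectors. It provides an orthogonal matrix with prescribed first
  column.\<close>

lemma householder_reflection:
  fixes v :: "real vec"
  assumes v: "v \<in> carrier_vec (Suc m)" and unit: "v \<bullet> v = 1"
  obtains H where "H \<in> carrier_mat (Suc m) (Suc m)" "transpose_mat H = H"
    "H * H = 1\<^sub>m (Suc m)" "col H 0 = v"
proof -
  define n where "n = Suc m"
  define u where "u i = v $ i - (if i = 0 then 1 else 0)" for i
  define s where "s = (\<Sum>i<n. u i * u i)"
  \<comment> \<open>If \<open>v\<close> is the first unit vector, then \<open>s = 0\<close>, and division by zero makes \<open>H\<close> the identity.\<close>
  define H where "H = Matrix.mat n n (\<lambda>(i, j). (if i = j then 1 else 0) - 2 / s * u i * u j)"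
  have vv: "(\<Sum>i<n. v $ i * v $ i) = 1"
    using unit v by (simp add: scalar_prod_def atLeast0LessThan n_def)
  \<comment> \<open>The squared length of the difference of two unit vectors is
    \<open>2 - 2 * v $ 0\<close>, which equals \<open>-2 * u 0\<close>. This relation is what later
    turns column 0 of \<open>H\<close> into \<open>v\<close>.\<close>
  have "s = (\<Sum>i<n. v $ i * v $ i - (if i = 0 then 2 * v $ 0 - 1 else 0))"
    unfolding s_def u_def by (intro sum.cong) (auto simp: algebra_simps)
  also have "\<dots> = -2 * u 0"
    using vv by (simp add: sum_subtractf n_def u_def)
  finally have s: "s = -2 * u 0" .
  have u0: "u i = 0" if "s = 0" "i < n" for i
    using that by (auto simp: s_def sum_nonneg_eq_0_iff)
  have H: "H \<in> carrier_mat n n"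
    by (simp add: H_def)
  moreover have "transpose_mat H = H"
    by (intro eq_matI) (auto simp: H_def)
  moreover have "H * H = 1\<^sub>m n"
  proof (rule eq_matI)
    fix i j assume "i < dim_row (1\<^sub>m n)" "j < dim_col (1\<^sub>m n)"
    then have ij: "i < n" "j < n" by auto
    have "(H * H) $$ (i, j) = (\<Sum>k<n. H $$ (i, k) * H $$ (k, j))"
      using ij H by (simp add: scalar_prod_def atLeast0LessThan)
    \<comment> \<open>The product is expanded into two terms supported at a single \<open>k\<close>
      and one proportional to \<open>u k * u k\<close>, so that summation over \<open>k\<close>
      yields two deltas and a multiple of \<open>s\<close>.\<close>
    also have "\<dots> =
        (\<Sum>k<n. (if k = i then (if i = j then 1 else 0) - 2 / s * u i * u j else 0)
           - (if k = j then 2 / s * u i * u j else 0)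
           + (2 / s) * (2 / s) * u i * u j * (u k * u k))"
    proof (rule sum.cong)
      fix k assume "k \<in> {..<n}"
      then have "H $$ (i, k) * H $$ (k, j) =
          ((if i = k then 1 else 0) - 2 / s * u i * u k) * ((if k = j then 1 else 0) - 2 / s * u k * u j)"
        using ij by (simp add: H_def)
      also have "\<dots> = (if k = i then (if i = j then 1 else 0) - 2 / s * u i * u j else 0)
           - (if k = j then 2 / s * u i * u j else 0)
           + (2 / s) * (2 / s) * u i * u j * (u k * u k)"
        by (cases "i = k"; cases "k = j") (simp_all add: algebra_simps)
      finally show "H $$ (i, k) * H $$ (k, j) = \<dots>" .
    qed simp
    also have "\<dots> = (if i = j then 1 else 0) - 2 * (2 / s * u i * u j) + (2 / s) * (2 / s) * u i * u j * s"
      using ij by (simp only: sum.distrib sum_subtractf sum_distrib_left[symmetric] s_def) simp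
    also have "\<dots> = (if i = j then 1 else 0)"
      by (cases "s = 0") (auto simp: field_simps)
    finally show "(H * H) $$ (i, j) = 1\<^sub>m n $$ (i, j)"
      using ij by simp
  qed (use H in auto)
  moreover have "col H 0 = v"
  proof (rule eq_vecI)
    fix i assume "i < dim_vec v"
    then have i: "i < n" using v by (simp add: n_def)
    then have "col H 0 $ i = (if i = 0 then 1 else 0) - 2 / s * u i * u 0"
      using H by (simp add: n_def) (simp add: H_def n_def)
    also have "\<dots> = (if i = 0 then 1 else 0) + u i"
      using u0[OF _ i] s by (cases "s = 0") (auto simp: field_simps)
    finally show "col H 0 $ i = v $ i"
      by (simp add: u_def)
  qed (use H v in \<open>simp add: n_def\<close>)
  ultimately show thesis
    using that by (simp add: n_def)
qed

lemma mat_diag_Suc: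
  "mat_diag (Suc m) d =
     four_block_mat (mat_diag 1 (\<lambda>_. d 0)) (0\<^sub>m 1 m) (0\<^sub>m m 1) (mat_diag m (\<lambda>i. d (Suc i)))"
  by (rule eq_matI) (auto simp: mat_diag_def)

lemma mat_of_zero_column_four_block:
  fixes M :: "'a :: zero mat"
  assumes M: "M \<in> carrier_mat (Suc m) (Suc m)" and sym: "transpose_mat M = M"
    and col: "\<And>i. 0 < i \<Longrightarrow> i < Suc m \<Longrightarrow> M $$ (i, 0) = 0"
  obtains k M' where "M' \<in> carrier_mat m m" "transpose_mat M' = M'"
    "M = four_block_mat (mat_diag 1 (\<lambda>_. k)) (0\<^sub>m 1 m) (0\<^sub>m m 1) M'"
proof
  have swap: "M $$ (i, j) = M $$ (j, i)" if "i < Suc m" "j < Suc m" for i j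
    using arg_cong[OF sym, of "\<lambda>X. X $$ (i, j)"] M that by simp
  have row: "M $$ (0, i) = 0" if "0 < i" "i < Suc m" for i
    using col[OF that] swap[of 0 i] that by simp
  define M' where "M' = Matrix.mat m m (\<lambda>(i, j). M $$ (Suc i, Suc j))"
  show "M' \<in> carrier_mat m m"
    by (simp add: M'_def)
  show "transpose_mat M' = M'"
    by (rule eq_matI) (auto simp: M'_def intro: swap)
  show "M = four_block_mat (mat_diag 1 (\<lambda>_. M $$ (0, 0))) (0\<^sub>m 1 m) (0\<^sub>m m 1) M'"
    using M col row by (intro eq_matI) (auto simp: M'_def mat_diag_def)
qed

lemma block_diag_conjugate:
  fixes R :: "'a :: comm_ring_1 mat"
  assumes "E \<in> carrier_mat k k" "D \<in> carrier_mat m m" "R \<in> carrier_mat m m" "T \<in> carrier_mat m m"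
  shows "four_block_mat (1\<^sub>m k) (0\<^sub>m k m) (0\<^sub>m m k) R * four_block_mat E (0\<^sub>m k m) (0\<^sub>m m k) D *
      four_block_mat (1\<^sub>m k) (0\<^sub>m k m) (0\<^sub>m m k) T =
    four_block_mat E (0\<^sub>m k m) (0\<^sub>m m k) (R * D * T)"
proof -
  have RD: "R * D \<in> carrier_mat m m"
    using assms by simp
  have "four_block_mat (1\<^sub>m k) (0\<^sub>m k m) (0\<^sub>m m k) R * four_block_mat E (0\<^sub>m k m) (0\<^sub>m m k) D =
      four_block_mat E (0\<^sub>m k m) (0\<^sub>m m k) (R * D)"
    using assms RD by (subst mult_four_block_mat[of _ k k _ m _ m _ _ k _ m]) auto
  then show ?thesis
    using assms RD by (subst \<open>_ = _\<close>, subst mult_four_block_mat[of _ k k _ m _ m _ _ k _ m]) auto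
qed

theorem real_spectral_theorem:
  fixes A :: "real mat"
  assumes "A \<in> carrier_mat n n" "transpose_mat A = A"
  shows "\<exists>Q d. Q \<in> carrier_mat n n \<and> transpose_mat Q * Q = 1\<^sub>m n \<and>
    A = Q * mat_diag n d * transpose_mat Q"
  using assms
proof (induction n arbitrary: A)
  case 0
  then show ?case
    by (intro exI[of _ "1\<^sub>m 0"] exI[of _ "\<lambda>_. 0"]) (auto intro!: eq_matI)
next
  case (Suc m)
  define n where "n = Suc m"
  note assoc = assoc_mult_mat[of _ n n _ n _ n]
  have A: "A \<in> carrier_mat n n" and sym: "transpose_mat A = A"
    using Suc.prems by (simp_all add: n_def)
  \<comment> \<open>Conjugating by a reflection that maps the first unit vector to an eigenvector splits off
     a one-dimensional block.\<close>
  obtain w k where w: "w \<in> carrier_vec n" "w \<noteq> 0\<^sub>v n" "A *\<^sub>v w = k \<cdot>\<^sub>v w"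
    using symmetric_mat_has_real_eigenvector[OF A sym] by (auto simp: n_def)
  define v where "v = (1 / sqrt (w \<bullet> w)) \<cdot>\<^sub>v w"
  have ww: "w \<bullet> w > 0"
    using scalar_prod_self_eq_0_iff[OF w(1)] w(2) scalar_prod_self_nonneg[of w] by linarith
  have v: "v \<in> carrier_vec n" "A *\<^sub>v v = k \<cdot>\<^sub>v v"
    using w A by (auto simp: v_def mult_mat_vec[of _ n n] smult_smult_assoc mult.commute)
  have "v \<bullet> v = 1"
    using ww w(1) by (simp add: v_def)
  with v(1) obtain H where H: "H \<in> carrier_mat n n" "transpose_mat H = H" "H * H = 1\<^sub>m n"
    and Hcol: "col H 0 = v"
    using householder_reflection[of v m] by (auto simp: n_def)
  define M where "M = H * (A * H)"
  have M: "M \<in> carrier_mat n n"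
    using H A by (simp add: M_def)
  have Msym: "transpose_mat M = M"
    using H A sym by (simp add: M_def transpose_mult[of _ n n _ n] assoc)
  have n0: "0 < n" by (simp add: n_def)
  \<comment> \<open>\<open>H\<close> moves the first unit vector to \<open>v\<close>,
    \<open>A\<close> scales it by \<open>k\<close>, and \<open>H * H = 1\<^sub>m n\<close> moves it
    back; so column 0 of \<open>M\<close> is zero below the diagonal.\<close>
  have "col M 0 = H *\<^sub>v (A *\<^sub>v col H 0)"
    unfolding M_def using H A n0 by (simp add: col_mult2[of _ n n _ n])
  also have "\<dots> = k \<cdot>\<^sub>v (H *\<^sub>v col H 0)"
    unfolding Hcol v(2) using H v(1) by (simp add: mult_mat_vec[of _ n n])
  also have "H *\<^sub>v col H 0 = col (H * H) 0"
    by (rule col_mult2[OF H(1,1) n0, symmetric])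
  finally have col: "col M 0 = k \<cdot>\<^sub>v unit_vec n 0"
    using H(3) n0 by simp
  have "M $$ (i, 0) = 0" if "0 < i" "i < Suc m" for i
    using arg_cong[OF col, of "\<lambda>w. w $ i"] that M by (simp add: n_def)
  with M Msym obtain e M' where M': "M' \<in> carrier_mat m m" "transpose_mat M' = M'"
    and Mblock: "M = four_block_mat (mat_diag 1 (\<lambda>_. e)) (0\<^sub>m 1 m) (0\<^sub>m m 1) M'"
    unfolding n_def by (rule mat_of_zero_column_four_block)
  obtain R d where R: "R \<in> carrier_mat m m" "transpose_mat R * R = 1\<^sub>m m"
    and M'R: "M' = R * mat_diag m d * transpose_mat R"
    using Suc.IH[OF M'] by blast
  define P where "P = four_block_mat (1\<^sub>m 1) (0\<^sub>m 1 m) (0\<^sub>m m 1) R"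
  define D where "D = mat_diag n (case_nat e d)"
  have P: "P \<in> carrier_mat n n" and D: "D \<in> carrier_mat n n"
    using R by (auto simp: P_def D_def n_def)
  have Pt: "transpose_mat P = four_block_mat (1\<^sub>m 1) (0\<^sub>m 1 m) (0\<^sub>m m 1) (transpose_mat R)"
    unfolding P_def using R by (subst transpose_four_block_mat[of _ 1 1 _ m _ m]) auto
  have PP: "transpose_mat P * P = 1\<^sub>m n"
    unfolding Pt unfolding P_def using R
    by (subst mult_four_block_mat[of _ 1 1 _ m _ m _ _ 1 _ m]) (auto simp: n_def)
  have Mdiag: "M = P * D * transpose_mat P"
    unfolding Pt unfolding D_def n_def mat_diag_Suc P_def Mblock M'R using R
    by (subst block_diag_conjugate) simp_all
  have HH: "H * (H * X) = X" if "X \<in> carrier_mat n n" for X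
    using that H by (simp flip: assoc)
  have "A = H * (M * H)"
    using H A by (simp add: M_def assoc HH)
  also have "\<dots> = (H * P) * D * transpose_mat (H * P)"
    unfolding Mdiag using H P D by (simp add: transpose_mult[of _ n n _ n] assoc)
  finally have "A = (H * P) * D * transpose_mat (H * P)" .
  moreover have "transpose_mat (H * P) * (H * P) = 1\<^sub>m n"
    using H P PP
    by (simp add: transpose_mult[of _ n n _ n] assoc HH)
  ultimately show ?case
    unfolding D_def n_def[symmetric] using H P by (intro exI[of _ "H * P"] exI[of _ "case_nat e d"]) auto
qed

section \<open>Inverse matrices and conjugation\<close>

lemma mat_inv_eqI:
  assumes "A \<in> carrier_mat n n" "B \<in> carrier_mat n n" "A * B = 1\<^sub>m n" "B * A = 1\<^sub>m n"
  shows "mat_inv A = B" "invertible_mat A"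
proof -
  show "mat_inv A = B"
    unfolding mat_inv_def
  proof (rule the_equality)
    show "inverts_mat A B \<and> inverts_mat B A"
      using assms by (simp add: inverts_mat_def)
    fix X assume X: "inverts_mat A X \<and> inverts_mat X A"
    then have AX: "A * X = 1\<^sub>m n" and XA: "X * A = 1\<^sub>m (dim_row X)"
      using assms(1) by (auto simp: inverts_mat_def)
    \<comment> \<open>The definite description ranges over matrices of all sizes; comparing column
      counts in the two products fixes the size of \<open>X\<close> before associativity is
      applied.\<close>
    have "dim_col X = n" "dim_row X = n"
      using arg_cong[OF AX, of dim_col] arg_cong[OF XA, of dim_col] assms(1) by auto
    then have "X \<in> carrier_mat n n" by blast
    then have "B * A * X = B * (A * X)"
      using assms by (intro assoc_mult_mat) auto
    then show "X = B"
      using \<open>X \<in> carrier_mat n n\<close> assms(2) unfolding assms(4) AX by simp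
  qed
  show "invertible_mat A"
    using assms unfolding invertible_mat_def by (auto simp: inverts_mat_def)
qed

text \<open>Intended for \<open>G = B C^(-1)\<close>, \<open>H = C D2\<close> and
  \<open>Y = C^(1/2) W^(-1/2)\<close>. Since \<open>Z\<close> inverts \<open>Y\<close>, the
  eigenvectors of \<open>Z * G * Y\<close> are carried to those of \<open>G\<close> by
  \<open>Y\<close>. One-sided inverses suffice because all matrices are square over a field.\<close>

lemma conjugated_diagonalisation:
  fixes Y Z G H Q D :: "real mat"
  assumes carr: "Y \<in> carrier_mat n n" "Z \<in> carrier_mat n n" "G \<in> carrier_mat n n"
      "H \<in> carrier_mat n n" "Q \<in> carrier_mat n n" "D \<in> carrier_mat n n"
    and YZ: "Y * Z = 1\<^sub>m n" and GH: "G * H = 1\<^sub>m n" and QQ: "transpose_mat Q * Q = 1\<^sub>m n"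
    and eq: "Z * G * Y = Q * D * transpose_mat Q"
  shows "invertible_mat (Y * Q)" "mat_inv (Y * Q) = transpose_mat Q * Z"
    "G = Y * Q * D * mat_inv (Y * Q)" "invertible_mat D"
    "H = Y * Q * mat_inv D * mat_inv (Y * Q)"
proof -
  let ?T = "transpose_mat Q"
  note assoc = assoc_mult_mat[of _ n n _ n _ n]
  have T: "?T \<in> carrier_mat n n" using carr by simp
  note carr = carr T
  have ZY: "Z * Y = 1\<^sub>m n" and HG: "H * G = 1\<^sub>m n" and QT: "Q * ?T = 1\<^sub>m n"
    using mat_mult_left_right_inverse YZ GH QQ carr by blast+
  have cancel:
    "Y * (Z * X) = X" "Z * (Y * X) = X" "G * (H * X) = X" "H * (G * X) = X" "Q * (?T * X) = X"
    "?T * (Q * X) = X" if "X \<in> carrier_mat n n" for X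
    using that carr by (simp_all add: YZ ZY GH HG QT QQ flip: assoc)
  have V: "Y * Q * (?T * Z) = 1\<^sub>m n" "?T * Z * (Y * Q) = 1\<^sub>m n"
    using carr by (simp_all add: assoc cancel YZ QQ)
  show inv: "mat_inv (Y * Q) = ?T * Z" and "invertible_mat (Y * Q)"
    using mat_inv_eqI[OF _ _ V] carr by auto
  have "Y * (Z * G * Y) * Z = G"
    using carr by (simp add: assoc cancel YZ)
  then show G: "G = Y * Q * D * mat_inv (Y * Q)"
    unfolding eq inv using carr by (simp add: assoc)
  \<comment> \<open>\<open>D\<close> is the conjugate of \<open>G\<close> by \<open>Y * Q\<close>,
    so the same conjugate of \<open>H\<close> is its inverse. Hence the diagonal factor is
    invertible because \<open>G\<close> is.\<close>
  define E where "E = ?T * Z * H * Y * Q"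
  have E: "E \<in> carrier_mat n n"
    unfolding E_def using carr by (intro mult_carrier_mat[of _ n n _ n])
  have "?T * (Z * G * Y) * Q = D"
    unfolding eq using carr by (simp add: assoc cancel QQ)
  then have "D * E = ?T * (Z * G * Y) * Q * E"
    by simp
  also have "\<dots> = 1\<^sub>m n"
    using carr by (simp add: assoc cancel E_def QQ)
  finally have DE: "D * E = 1\<^sub>m n" .
  then have ED: "E * D = 1\<^sub>m n"
    using mat_mult_left_right_inverse carr E by blast
  show "invertible_mat D"
    using mat_inv_eqI[OF _ _ DE ED] carr E by simp
  have "mat_inv D = E"
    using mat_inv_eqI[OF _ _ DE ED] carr E by simp
  then show "H = Y * Q * mat_inv D * mat_inv (Y * Q)"
    unfolding inv using carr by (simp add: E_def assoc cancel YZ)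
qed

section \<open>Polynomials\<close>

lemma pderiv_sum: "pderiv (sum f A) = (\<Sum>a\<in>A. pderiv (f a))"
  using higher_pderiv_sum[of 1 f A] by simp

lemma exists_poly_antiderivative:
  fixes p :: "'a :: field_char_0 poly"
  obtains q where "pderiv q = p" "degree q \<le> Suc (degree p)"
proof
  let ?q = "\<Sum>i\<le>degree p. monom (coeff p i / of_nat (Suc i)) (Suc i)"
  have "pderiv ?q = (\<Sum>i\<le>degree p. monom (coeff p i) i)"
    by (simp add: pderiv_sum pderiv_monom del: of_nat_Suc)
  then show "pderiv ?q = p"
    by (simp add: poly_as_sum_of_monoms)
  show "degree ?q \<le> Suc (degree p)"
    by (intro degree_sum_le order_trans[OF degree_monom_le]) auto
qed

text \<open>The product over the other points, normalised at \<open>a\<close>. It yields the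
  Lagrange basis on all nodes and the second derivatives of the Birkhoff polynomials on the interior
  nodes.\<close>

lemma exists_indicator_poly:
  fixes A :: "'a :: field set"
  assumes "finite A" "a \<in> A"
  obtains p where "degree p \<le> card A - 1" "\<And>b. b \<in> A \<Longrightarrow> poly p b = (if b = a then 1 else 0)"
proof
  let ?r = "\<Prod>b\<in>A - {a}. [:-b, 1:]"
  let ?p = "Polynomial.smult (1 / poly ?r a) ?r"
  have "degree ?r \<le> (\<Sum>b\<in>A - {a}. 1)"
    using degree_prod_sum_le[of "A - {a}" "\<lambda>b. [:-b, 1:]"] assms by simp
  then show "degree ?p \<le> card A - 1"
    using assms degree_smult_le[of "1 / poly ?r a" ?r] by (simp add: card_Diff_singleton)
  fix b assume "b \<in> A"
  moreover have "poly ?r a \<noteq> 0"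
    using assms by (simp add: poly_prod)
  moreover have "poly ?r b = 0" if "b \<in> A" "b \<noteq> a"
    using assms that by (auto simp: poly_prod)
  ultimately show "poly ?p b = (if b = a then 1 else 0)"
    by auto
qed

lemma degree_le_1_eq_0_of_two_zeros:
  fixes p :: "'a :: idom poly"
  assumes "degree p \<le> 1" "poly p a = 0" "poly p b = 0" "a \<noteq> b"
  shows "p = 0"
  using assms by (intro poly_eqI_degree[of "{a, b}"]) auto

lemma poly_continuous_on: "continuous_on S (poly p)" for p :: "real poly"
  by (intro continuous_intros)

lemma integral_poly_pderiv:
  fixes p :: "real poly"
  assumes "a \<le> b"
  shows "integral {a..b} (poly (pderiv p)) = poly p b - poly p a"
proof (intro integral_unique fundamental_theorem_of_calculus assms)
  fix t
  show "(poly p has_vector_derivative poly (pderiv p) t) (at t within {a..b})"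
    using DERIV_subset[OF poly_DERIV[of p t]]
    unfolding has_real_derivative_iff_has_vector_derivative[symmetric] by simp
qed

lemma integral_poly_mult_pderiv2:
  fixes p q :: "real poly"
  assumes "a \<le> b" "poly p a = 0" "poly p b = 0"
  shows "integral {a..b} (poly (p * pderiv (pderiv q))) =
    - integral {a..b} (poly (pderiv p * pderiv q))"
proof -
  have int: "poly r integrable_on {a..b}" for r :: "real poly"
    by (intro integrable_continuous_real poly_continuous_on)
  have "integral {a..b} (poly (pderiv (p * pderiv q))) = 0"
    using integral_poly_pderiv[of a b "p * pderiv q"] assms by simp
  also have "poly (pderiv (p * pderiv q)) =
      (\<lambda>t. poly (p * pderiv (pderiv q)) t + poly (pderiv p * pderiv q) t)"
    by (auto simp: pderiv_mult mult.commute)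
  finally show ?thesis
    using integral_add[OF int int, of "p * pderiv (pderiv q)" "pderiv p * pderiv q"] by simp
qed

text \<open>A continuous nonnegative function with zero integral vanishes on the whole interval,
  giving \<open>p\<close> infinitely many roots.\<close>

lemma integral_poly_square_pos:
  fixes p :: "real poly"
  assumes "a < b" "p \<noteq> 0"
  shows "integral {a..b} (poly (p * p)) > 0"
proof -
  have "integral {a..b} (poly (p * p)) \<ge> 0"
    by (intro integral_nonneg integrable_continuous_real poly_continuous_on) auto
  moreover have "integral {a..b} (poly (p * p)) \<noteq> 0"
  proof
    assume "integral {a..b} (poly (p * p)) = 0"
    then have "\<forall>t\<in>{a..b}. poly (p * p) t = 0"
      using integral_eq_0_iff[OF poly_continuous_on assms(1), of "p * p"] by simp
    then have "{a..b} \<subseteq> {t. poly p t = 0}" by auto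
    then show False
      using finite_subset[OF _ poly_roots_finite[OF assms(2)]] infinite_Icc[OF assms(1)] by blast
  qed
  ultimately show ?thesis by linarith
qed

section \<open>Birkhoff interpolation at quadrature nodes\<close>

text \<open>Isolates the properties of the nodes and weights on which the interpolation argument
  rests; \<open>inj\<close> will come from the strict monotonicity in
  \<open>lgl_nodes\<close>.\<close>

locale lobatto_quadrature =
  fixes N :: nat and x \<omega> :: "nat \<Rightarrow> real"
  assumes N: "N \<ge> 2"
    and node_0: "x 0 = -1" and node_N: "x N = 1"
    and inj: "inj_on x {0..N}"
    and weights: "lgl_weights N x \<omega>"
begin

lemma weight_pos: "i \<le> N \<Longrightarrow> \<omega> i > 0"
  using weights by (simp add: lgl_weights_def)

lemma node_eq_iff: "i \<le> N \<Longrightarrow> j \<le> N \<Longrightarrow> x i = x j \<longleftrightarrow> i = j"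
  using inj by (auto simp: inj_on_def)

lemma card_interior_nodes: "card (x ` {1..N-1}) = N - 1"
  by (simp add: card_image inj_on_subset[OF inj])

lemma quadrature_mult_pderiv2:
  assumes "degree p \<le> N" "degree q \<le> N" "poly p (-1) = 0" "poly p 1 = 0"
  shows "(\<Sum>i=1..N-1. \<omega> i * poly p (x i) * poly (pderiv (pderiv q)) (x i)) =
    - integral {-1..1} (poly (pderiv p * pderiv q))"
proof -
  let ?r = "p * pderiv (pderiv q)"
  have "degree ?r \<le> N + (N - 1 - 1)"
    using assms by (intro order_trans[OF degree_mult_le] add_mono) (auto simp: degree_pderiv)
  then have "degree ?r \<le> 2 * N - 1"
    using N by linarith
  then have "(\<Sum>i=0..N. poly ?r (x i) * \<omega> i) = integral {-1..1} (poly ?r)"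
    using weights unfolding lgl_weights_def by metis
  moreover have "(\<Sum>i=0..N. poly ?r (x i) * \<omega> i) = (\<Sum>i=1..N-1. poly ?r (x i) * \<omega> i)"
  proof (rule sum.mono_neutral_right)
    show "\<forall>i\<in>{0..N} - {1..N-1}. poly ?r (x i) * \<omega> i = 0"
    proof
      fix i assume "i \<in> {0..N} - {1..N-1}"
      then have "i = 0 \<or> i = N" by auto
      then show "poly ?r (x i) * \<omega> i = 0"
        using assms node_0 node_N by auto
    qed
  qed auto
  ultimately show ?thesis
    using integral_poly_mult_pderiv2[of "-1" 1 p q] assms by (simp add: mult_ac)
qed

text \<open>The second derivative has degree at most \<open>N - 2\<close> and \<open>N - 1\<close>
  distinct zeros, so \<open>p\<close> is affine, and its zeros at the endpoints finish. This is
  uniqueness of Birkhoff interpolation.\<close>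

lemma eq_0_of_pderiv2_zero:
  assumes "degree p \<le> N" "poly p (-1) = 0" "poly p 1 = 0"
    and "\<And>i. i \<in> {1..N-1} \<Longrightarrow> poly (pderiv (pderiv p)) (x i) = 0"
  shows "p = 0"
proof -
  have "pderiv (pderiv p) = 0"
    using assms N card_interior_nodes
    by (intro poly_eqI_degree[of "x ` {1..N-1}"]) (auto simp: degree_pderiv)
  then have "degree p \<le> 1"
    by (simp add: pderiv_eq_0_iff degree_pderiv)
  then show ?thesis
    using assms by (intro degree_le_1_eq_0_of_two_zeros[of p "-1" 1]) auto
qed

text \<open>Discrete integration by parts with \<open>q = p\<close> gives minus the integral of the
  squared derivative, which is nonzero because a nonzero \<open>p\<close> with two zeros is not
  constant.\<close>

lemma quadrature_negative:
  assumes "degree p \<le> N" "poly p (-1) = 0" "poly p 1 = 0" "p \<noteq> 0"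
  shows "(\<Sum>i=1..N-1. \<omega> i * poly p (x i) * poly (pderiv (pderiv p)) (x i)) < 0"
proof -
  have "\<not> degree p \<le> 1"
    using degree_le_1_eq_0_of_two_zeros[of p "-1" 1] assms by auto
  then have "pderiv p \<noteq> 0"
    by (simp add: pderiv_eq_0_iff)
  then show ?thesis
    using quadrature_mult_pderiv2[OF assms(1,1,2,3)] integral_poly_square_pos[of "-1" 1 "pderiv p"]
    by simp
qed

text \<open>Prescribe the second derivative by an indicator polynomial on the interior nodes,
  integrate twice, and correct the boundary values by an affine function.\<close>

lemma exists_birkhoff_poly:
  assumes j: "j \<in> {1..N-1}"
  shows "\<exists>p. degree p \<le> N \<and> poly p (-1) = 0 \<and> poly p 1 = 0 \<and>
    (\<forall>i\<in>{1..N-1}. poly (pderiv (pderiv p)) (x i) = (if i = j then 1 else 0))"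
proof -
  have "finite (x ` {1..N-1})" "x j \<in> x ` {1..N-1}" using j by auto
  then obtain m where m: "degree m \<le> N - 1 - 1"
    "\<And>b. b \<in> x ` {1..N-1} \<Longrightarrow> poly m b = (if b = x j then 1 else 0)"
    using exists_indicator_poly[of "x ` {1..N-1}" "x j"] card_interior_nodes by auto
  obtain q where q: "pderiv q = m" "degree q \<le> Suc (degree m)"
    using exists_poly_antiderivative by blast
  obtain r where r: "pderiv r = q" "degree r \<le> Suc (degree q)"
    using exists_poly_antiderivative by blast
  \<comment> \<open>The affine interpolant of \<open>r\<close> at -1 and 1; subtracting it leaves
    the second derivative unchanged.\<close>
  let ?l = "[:(poly r 1 + poly r (-1)) / 2, (poly r 1 - poly r (-1)) / 2:]"
  have "degree ?l \<le> N" "degree r \<le> N"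
    using N m(1) q(2) r(2) by auto
  then have "degree (r - ?l) \<le> N"
    by (intro degree_diff_le)
  moreover have "poly (r - ?l) (-1) = 0" "poly (r - ?l) 1 = 0"
    by (simp_all add: field_simps)
  moreover have "pderiv (pderiv (r - ?l)) = m"
    using q(1) r(1) by (simp add: pderiv_diff pderiv_pCons)
  moreover have "poly m (x i) = (if i = j then 1 else 0)" if "i \<in> {1..N-1}" for i
    using m(2)[of "x i"] node_eq_iff[of i j] that j by auto
  ultimately show ?thesis by metis
qed

lemma birkhoff_poly:
  assumes j: "j \<in> {1..N-1}"
  defines "p \<equiv> birkhoff_poly N x j"
  shows "degree p \<le> N" "poly p (-1) = 0" "poly p 1 = 0"
    "\<And>i. i \<in> {1..N-1} \<Longrightarrow> poly (pderiv (pderiv p)) (x i) = (if i = j then 1 else 0)"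
proof -
  let ?P = "\<lambda>p. degree p \<le> N \<and> poly p (-1) = 0 \<and> poly p 1 = 0 \<and>
    (\<forall>i\<in>{1..N-1}. poly (pderiv (pderiv p)) (x i) = (if i = j then 1 else 0))"
  have "q = r" if "?P q" "?P r" for q r
  proof -
    have "q - r = 0"
      using that by (intro eq_0_of_pderiv2_zero) (auto simp: pderiv_diff intro: degree_diff_le)
    then show ?thesis by simp
  qed
  then have "\<exists>!p. ?P p"
    using exists_birkhoff_poly[OF j] by blast
  then have "?P p"
    unfolding p_def birkhoff_poly_def by (rule theI')
  then show "degree p \<le> N" "poly p (-1) = 0" "poly p 1 = 0"
    "\<And>i. i \<in> {1..N-1} \<Longrightarrow> poly (pderiv (pderiv p)) (x i) = (if i = j then 1 else 0)"
    by blast+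
qed

lemma lagrange_poly:
  assumes j: "j \<le> N"
  defines "p \<equiv> lagrange_poly N x j"
  shows "degree p \<le> N" "\<And>i. i \<le> N \<Longrightarrow> poly p (x i) = (if i = j then 1 else 0)"
proof -
  let ?P = "\<lambda>p. degree p \<le> N \<and> (\<forall>i\<in>{0..N}. poly p (x i) = (if i = j then 1 else 0))"
  have card: "card (x ` {0..N}) = Suc N"
    using card_image[OF inj] by simp
  have "finite (x ` {0..N})" "x j \<in> x ` {0..N}" using j by auto
  then obtain m where m: "degree m \<le> N"
    "\<And>b. b \<in> x ` {0..N} \<Longrightarrow> poly m b = (if b = x j then 1 else 0)"
    using exists_indicator_poly[of "x ` {0..N}" "x j"] card by auto
  have "?P m"
    using m node_eq_iff j by auto
  moreover have "q = r" if "?P q" "?P r" for q r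
    using that card by (intro poly_eqI_degree[of "x ` {0..N}"]) auto
  ultimately have "\<exists>!p. ?P p"
    by blast
  then have "?P p"
    unfolding p_def lagrange_poly_def by (rule theI')
  then show "degree p \<le> N" "\<And>i. i \<le> N \<Longrightarrow> poly p (x i) = (if i = j then 1 else 0)"
    by auto
qed

text \<open>The terms for the two endpoints are absent because \<open>p\<close> vanishes there; both
  sides agree at \<open>N + 1\<close> nodes and have degree at most \<open>N\<close>.\<close>

lemma lagrange_expansion:
  assumes "degree p \<le> N" "poly p (-1) = 0" "poly p 1 = 0"
  shows "p = (\<Sum>k=1..N-1. Polynomial.smult (poly p (x k)) (lagrange_poly N x k))"
    (is "p = ?s")
proof (rule poly_eqI_degree[of "x ` {0..N}"])
  have card: "card (x ` {0..N}) = Suc N"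
    using card_image[OF inj] by simp
  show "degree p < card (x ` {0..N})"
    using assms card by simp
  have "degree ?s \<le> N"
    by (intro degree_sum_le order_trans[OF degree_smult_le] lagrange_poly) auto
  then show "degree ?s < card (x ` {0..N})"
    using card by simp
  fix t assume "t \<in> x ` {0..N}"
  then obtain i where i: "i \<le> N" "t = x i" by auto
  have "poly ?s t = (\<Sum>k=1..N-1. if k = i then poly p (x i) else 0)"
    unfolding poly_sum using i by (intro sum.cong) (auto simp: lagrange_poly)
  also have "\<dots> = poly p t"
  proof (cases "i \<in> {1..N-1}")
    case False
    then have "i = 0 \<or> i = N" using i by auto
    then show ?thesis using False assms node_0 node_N i by auto
  qed (use i in simp)
  finally show "poly p t = poly ?s t" ..
qed

lemma birkhoff_mat_carrier: "birkhoff_mat N x \<in> carrier_mat (N - 1) (N - 1)"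
  by (simp add: birkhoff_mat_def interior_mat_def)

lemma diff_mat2_carrier: "diff_mat2 N x \<in> carrier_mat (N - 1) (N - 1)"
  by (simp add: diff_mat2_def interior_mat_def)

text \<open>Expand a Birkhoff polynomial in the interior Lagrange basis, differentiate twice and
  evaluate at an interior node: the coefficients are the entries of one column of the Birkhoff
  matrix.\<close>

lemma diff_mat2_birkhoff_mat: "diff_mat2 N x * birkhoff_mat N x = 1\<^sub>m (N - 1)"
proof (rule eq_matI)
  fix i j assume "i < dim_row (1\<^sub>m (N - 1) :: real mat)" "j < dim_col (1\<^sub>m (N - 1) :: real mat)"
  then have ij: "i < N - 1" "j < N - 1" "Suc i \<in> {1..N-1}" "Suc j \<in> {1..N-1}" by auto
  let ?p = "birkhoff_poly N x (Suc j)"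
  have "(diff_mat2 N x * birkhoff_mat N x) $$ (i, j) =
      (\<Sum>k<N-1. poly (pderiv (pderiv (lagrange_poly N x (Suc k)))) (x (Suc i)) * poly ?p (x (Suc k)))"
    using ij by (simp add: diff_mat2_def birkhoff_mat_def interior_mat_def scalar_prod_def
        atLeast0LessThan)
  also have "\<dots> = poly (pderiv (pderiv
      (\<Sum>k=1..N-1. Polynomial.smult (poly ?p (x k)) (lagrange_poly N x k)))) (x (Suc i))"
    by (simp add: pderiv_sum pderiv_smult poly_sum mult.commute sum.atLeast1_atMost_eq)
  also have "\<dots> = poly (pderiv (pderiv ?p)) (x (Suc i))"
    by (subst lagrange_expansion[of ?p, symmetric]) (simp_all add: birkhoff_poly[OF ij(4)])
  also have "\<dots> = (if i = j then 1 else 0)"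
    using birkhoff_poly[OF ij(4)] ij(3) by simp
  finally show "(diff_mat2 N x * birkhoff_mat N x) $$ (i, j) = 1\<^sub>m (N - 1) $$ (i, j)"
    using ij by simp
qed (simp_all add: diff_mat2_def birkhoff_mat_def interior_mat_def)

text \<open>The second derivative of a Birkhoff polynomial reduces the quadrature sum to a single
  node, so each side is an integral that is symmetric in the two indices.\<close>

lemma birkhoff_values_symmetric:
  assumes i: "i \<in> {1..N-1}" and j: "j \<in> {1..N-1}"
  shows "\<omega> i * poly (birkhoff_poly N x j) (x i) = \<omega> j * poly (birkhoff_poly N x i) (x j)"
proof -
  have *: "\<omega> a * poly (birkhoff_poly N x b) (x a) =
      - integral {-1..1} (poly (pderiv (birkhoff_poly N x b) * pderiv (birkhoff_poly N x a)))"
    if a: "a \<in> {1..N-1}" and b: "b \<in> {1..N-1}" for a b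
  proof -
    have "(\<Sum>k=1..N-1. \<omega> k * poly (birkhoff_poly N x b) (x k) *
        poly (pderiv (pderiv (birkhoff_poly N x a))) (x k)) =
      (\<Sum>k=1..N-1. if k = a then \<omega> a * poly (birkhoff_poly N x b) (x a) else 0)"
      by (intro sum.cong) (auto simp: birkhoff_poly(4)[OF a])
    then show ?thesis
      using quadrature_mult_pderiv2[of "birkhoff_poly N x b" "birkhoff_poly N x a"]
        birkhoff_poly[OF a] birkhoff_poly[OF b] a by simp
  qed
  show ?thesis
    using *[OF i j] *[OF j i] by (simp add: mult.commute)
qed

text \<open>With \<open>y\<close> as coefficients, the combination \<open>p\<close> of Birkhoff
  polynomials has second derivative \<open>y i\<close> at \<open>x i\<close>, so the quadratic form
  is the quadrature sum of \<open>p\<close> times its second derivative.\<close>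

lemma birkhoff_quadratic_form_negative:
  assumes "j \<in> {1..N-1}" "y j \<noteq> 0"
  shows "(\<Sum>i=1..N-1. \<Sum>j=1..N-1. \<omega> i * y i * y j * poly (birkhoff_poly N x j) (x i)) < 0"
proof -
  define p where "p = (\<Sum>j=1..N-1. Polynomial.smult (y j) (birkhoff_poly N x j))"
  have "degree p \<le> N"
    unfolding p_def
    by (intro degree_sum_le order_trans[OF degree_smult_le] birkhoff_poly) auto
  moreover have "poly p (-1) = 0" "poly p 1 = 0"
    unfolding p_def poly_sum by (auto intro!: sum.neutral simp: birkhoff_poly)
  moreover have p2: "poly (pderiv (pderiv p)) (x i) = y i" if i: "i \<in> {1..N-1}" for i
  proof -
    have "poly (pderiv (pderiv p)) (x i) = (\<Sum>j=1..N-1. if j = i then y i else 0)"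
      unfolding p_def pderiv_sum poly_sum pderiv_smult poly_smult
      by (intro sum.cong) (auto simp: birkhoff_poly(4)[OF _ i])
    then show ?thesis using i by simp
  qed
  moreover have "p \<noteq> 0"
    using p2[OF assms(1)] assms(2) by auto
  ultimately have "(\<Sum>i=1..N-1. \<omega> i * poly p (x i) * poly (pderiv (pderiv p)) (x i)) < 0"
    using quadrature_negative by blast
  also have "(\<Sum>i=1..N-1. \<omega> i * poly p (x i) * poly (pderiv (pderiv p)) (x i)) =
      (\<Sum>i=1..N-1. \<Sum>j=1..N-1. \<omega> i * y i * y j * poly (birkhoff_poly N x j) (x i))"
    by (intro sum.cong refl, simp add: p2)
      (simp add: p_def poly_sum sum_distrib_left sum_distrib_right mult_ac)
  finally show ?thesis .
qed

end

section \<open>The scaled Birkhoff matrix\<close>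

lemma diag_powr_interior_diag:
  "diag_powr (interior_diag N d) r = mat_diag (N - 1) (\<lambda>i. d (i + 1) powr r)"
  by (rule eq_matI) (auto simp: diag_powr_def interior_diag_def mat_diag_def)

text \<open>Undoes the index shift in \<open>interior_diag\<close>, so that the eigenvalues from the
  spectral theorem, numbered from 0, fit the required form.\<close>

lemma interior_diag_shift: "interior_diag N (\<lambda>i. d (i - 1)) = mat_diag (N - 1) d"
  by (simp add: interior_diag_def)

lemma diagonal_mat_diag: "diagonal_mat (mat_diag n d)"
  by (simp add: diagonal_mat_def mat_diag_def)

lemma (in lobatto_quadrature) scaled_birkhoff_mat:
  assumes c: "\<forall>i\<in>{1..N-1}. c i > 0"
  defines "g \<equiv> \<lambda>i. c i powr (-1/2) * \<omega> i powr (-1/2)"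
  defines "W \<equiv> interior_diag N \<omega>" and "C \<equiv> interior_diag N c"
  shows "diag_powr W (1/2) * (diag_powr C (-1/2) * birkhoff_mat N x * diag_powr C (-1/2)) *
      diag_powr W (-1/2) =
    interior_mat N (\<lambda>i j. g i * g j * (\<omega> i * poly (birkhoff_poly N x j) (x i)))"
    (is "?S = ?T")
proof (rule eq_matI)
  fix i j assume "i < dim_row ?T" "j < dim_col ?T"
  then have ij: "i < N - 1" "j < N - 1"
    by (simp_all add: interior_mat_def)
  have "\<omega> (Suc i) > 0"
    using ij by (intro weight_pos) auto
  \<comment> \<open>Splitting off a full factor of the weight leaves the exponent -1/2 on the left
    as on the right, which exhibits the scaled matrix as a congruence of \<open>W B\<close>.\<close>
  then have half: "\<omega> (Suc i) powr (1/2) = \<omega> (Suc i) powr (-1/2) * \<omega> (Suc i)"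
    using powr_mult_base[of "\<omega> (Suc i)" "-1/2"] by (simp add: mult.commute)
  show "?S $$ (i, j) = ?T $$ (i, j)"
    using ij birkhoff_mat_carrier
    unfolding W_def C_def diag_powr_interior_diag
    by (simp add: mat_diag_mult_left[of _ _ "N - 1"] mat_diag_mult_right[of _ "N - 1"] g_def half
        interior_mat_def birkhoff_mat_def)
qed (simp_all add: W_def C_def diag_powr_def interior_diag_def interior_mat_def mat_diag_def)

lemma (in lobatto_quadrature) scaled_birkhoff_mat_negative_definite:
  assumes g: "\<forall>i\<in>{1..N-1}. g i \<noteq> 0"
  shows "symmetric_negative_definite
    (interior_mat N (\<lambda>i j. g i * g j * (\<omega> i * poly (birkhoff_poly N x j) (x i))))"
    (is "symmetric_negative_definite ?S")
proof -
  have S: "?S \<in> carrier_mat (N - 1) (N - 1)"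
    by (simp add: interior_mat_def)
  have "transpose_mat ?S = ?S"
    by (rule eq_matI) (auto simp: interior_mat_def birkhoff_values_symmetric)
  moreover have "v \<bullet> (?S *\<^sub>v v) < 0" if v: "v \<in> carrier_vec (N - 1)" "v \<noteq> 0\<^sub>v (N - 1)" for v
  proof -
    \<comment> \<open>The scaling is absorbed into the vector; \<open>y\<close> is numbered from 1
      like the interior nodes, \<open>v\<close> from 0.\<close>
    define y where "y k = v $ (k - 1) * g k" for k
    obtain j where j: "j < N - 1" "v $ j \<noteq> 0"
      using v by (metis carrier_vecD eq_vecI index_zero_vec)
    then have "y (Suc j) \<noteq> 0"
      using g by (simp add: y_def)
    then have "(\<Sum>i=1..N-1. \<Sum>j=1..N-1. \<omega> i * y i * y j * poly (birkhoff_poly N x j) (x i)) < 0"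
      using j by (intro birkhoff_quadratic_form_negative[of "Suc j"]) auto
    also have "(\<Sum>i=1..N-1. \<Sum>j=1..N-1. \<omega> i * y i * y j * poly (birkhoff_poly N x j) (x i)) =
        v \<bullet> (?S *\<^sub>v v)"
      using v by (simp add: scalar_prod_def interior_mat_def atLeast0LessThan y_def
          sum.atLeast1_atMost_eq sum_distrib_left mult_ac)
    finally show ?thesis .
  qed
  ultimately show ?thesis
    using S by (auto simp: symmetric_negative_definite_def)
qed

theorem theorem2p1:
  fixes N :: nat and x \<omega> c :: "nat \<Rightarrow> real" and W C D2 B Bc Sc :: "real mat"
  assumes "N \<ge> 2"
    and "lgl_nodes N x"
    and "lgl_weights N x \<omega>"
    and "\<forall>i\<in>{1..N-1}. c i > 0"
    and "W = interior_diag N \<omega>"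
    and "C = interior_diag N c"
    and "D2 = diff_mat2 N x"
    and "B = birkhoff_mat N x"
    and "Bc = diag_powr C (-1/2) * B * diag_powr C (-1/2)"
    and "Sc = diag_powr W (1/2) * Bc * diag_powr W (-1/2)"
  shows "symmetric_negative_definite Sc \<and>
    (\<exists>Q \<sigma>. orthogonal_diagonalisation Sc Q (interior_diag N \<sigma>)) \<and>
    (\<forall>Q \<sigma>. orthogonal_diagonalisation Sc Q (interior_diag N \<sigma>) \<longrightarrow>
      (let \<Sigma> = interior_diag N \<sigma>;
           V = diag_powr C (1/2) * diag_powr W (-1/2) * Q
       in invertible_mat V \<and>
          mat_inv V = transpose_mat Q * diag_powr W (1/2) * diag_powr C (-1/2) \<and>
          B * diag_powr C (-1) = V * \<Sigma> * mat_inv V \<and>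
          invertible_mat \<Sigma> \<and>
          C * D2 = V * mat_inv \<Sigma> * mat_inv V))"
proof -
  have mono: "strict_mono_on {0..N} x" and ends: "x 0 = -1" "x N = 1"
    using assms(2) by (simp_all add: lgl_nodes_def)
  interpret lobatto_quadrature N x \<omega>
    by unfold_locales
      (use assms(1,3) ends strict_mono_on_imp_inj_on[OF mono] in auto)
  define n where "n = N - 1"
  have pos: "\<omega> (i + 1) > 0" "c (i + 1) > 0" if "i < n" for i
    using that assms(4) by (auto simp: n_def intro: weight_pos)
  have diag: "diag_powr W r = mat_diag n (\<lambda>i. \<omega> (i + 1) powr r)"
    "diag_powr C r = mat_diag n (\<lambda>i. c (i + 1) powr r)" for r
    unfolding assms(5,6) diag_powr_interior_diag n_def by simp_all
  have B: "B \<in> carrier_mat n n" and D2: "D2 \<in> carrier_mat n n"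
    using birkhoff_mat_carrier diff_mat2_carrier by (simp_all add: assms n_def)
  \<comment> \<open>A one-sided inverse of a square matrix is two-sided, so the two factors may be
    exchanged.\<close>
  have BD: "B * D2 = 1\<^sub>m n"
    using diff_mat2_birkhoff_mat mat_mult_left_right_inverse[OF D2 B] by (simp add: assms n_def)
  have dW: "diag_powr W r \<in> carrier_mat n n" and dC: "diag_powr C r \<in> carrier_mat n n" for r
    by (simp_all add: diag)
  have C_eq: "C = mat_diag n (\<lambda>i. c (i + 1))"
    by (simp add: assms(6) interior_diag_def n_def)
  then have C: "C \<in> carrier_mat n n"
    by simp
  have diag_cong: "mat_diag n f = mat_diag n h" if "\<And>i. i < n \<Longrightarrow> f i = h i" for f h :: "nat \<Rightarrow> real"
    using that by (auto simp: mat_diag_def)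
  have powW: "diag_powr W r * diag_powr W s = diag_powr W (r + s)" for r s
    by (simp add: diag powr_add)
  have powC: "diag_powr C r * diag_powr C s = diag_powr C (r + s)" for r s
    by (simp add: diag powr_add)
  \<comment> \<open>Since \<open>0 powr 0\<close> is 0, positivity of the diagonal entries is what
    makes the zeroth power the identity.\<close>
  have pow0: "diag_powr W 0 = 1\<^sub>m n" "diag_powr C 0 = 1\<^sub>m n"
    using diag_cong[of "\<lambda>i. \<omega> (i + 1) powr 0" "\<lambda>_. 1"] diag_cong[of "\<lambda>i. c (i + 1) powr 0" "\<lambda>_. 1"]
      pos by (force simp: diag)+
  have "diag_powr C 1 = C"
    unfolding diag(2) unfolding C_eq using pos(2) by (intro diag_cong) (simp add: abs_of_pos)
  note assoc = assoc_mult_mat[of _ n n _ n _ n] and mult = mult_carrier_mat[of _ n n _ n]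
  have Sc: "Sc \<in> carrier_mat n n"
    unfolding assms(9,10) by (intro mult dW dC B)

  have "\<forall>i\<in>{1..N-1}. c i powr (-1/2) * \<omega> i powr (-1/2) \<noteq> 0"
  proof
    fix i assume "i \<in> {1..N-1}"
    then have "c i > 0" "\<omega> i > 0"
      using assms(4) by (auto intro: weight_pos)
    then show "c i powr (-1/2) * \<omega> i powr (-1/2) \<noteq> 0"
      by simp
  qed
  then have neg: "symmetric_negative_definite Sc"
    unfolding assms(5,6,8,9,10) scaled_birkhoff_mat[OF assms(4)]
    by (rule scaled_birkhoff_mat_negative_definite)
  then have "transpose_mat Sc = Sc"
    by (simp add: symmetric_negative_definite_def)
  then obtain Q d where "Q \<in> carrier_mat n n" "transpose_mat Q * Q = 1\<^sub>m n"
    "Sc = Q * mat_diag n d * transpose_mat Q"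
    using real_spectral_theorem[OF Sc] by blast
  then have "orthogonal_diagonalisation Sc Q (interior_diag N (\<lambda>i. d (i - 1)))"
    using Sc unfolding interior_diag_shift n_def[symmetric]
    by (simp add: orthogonal_diagonalisation_def diagonal_mat_diag)
  then have ex: "\<exists>Q \<sigma>. orthogonal_diagonalisation Sc Q (interior_diag N \<sigma>)"
    by blast

  define Y where "Y = diag_powr C (1/2) * diag_powr W (-1/2)"
  define Z where "Z = diag_powr W (1/2) * diag_powr C (-1/2)"
  have YZ: "Y \<in> carrier_mat n n" "Z \<in> carrier_mat n n"
    unfolding Y_def Z_def by (intro mult dW dC)+
  have "Y * Z = diag_powr C (1/2) * (diag_powr W (-1/2) * diag_powr W (1/2)) * diag_powr C (-1/2)"
    unfolding Y_def Z_def using dW dC by (simp add: assoc mult)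
  then have YZ1: "Y * Z = 1\<^sub>m n"
    by (simp add: powW powC pow0 right_mult_one_mat[OF dC])
  have "B * diag_powr C (-1) * (C * D2) = B * (diag_powr C (-1) * diag_powr C 1) * D2"
    unfolding \<open>diag_powr C 1 = C\<close> using B C D2 dC by (simp add: assoc mult)
  then have GH: "B * diag_powr C (-1) * (C * D2) = 1\<^sub>m n"
    by (simp add: powC pow0 right_mult_one_mat[OF B] BD)
  \<comment> \<open>To the right of \<open>B\<close> the exponents of \<open>C\<close> add up to -1
    + 1/2 = -1/2, matching the power on its left.\<close>
  have "Z * (B * diag_powr C (-1)) * Y =
      diag_powr W (1/2) * (diag_powr C (-1/2) * B * (diag_powr C (-1) * diag_powr C (1/2))) *
      diag_powr W (-1/2)"
    unfolding Y_def Z_def using B dC dW by (simp add: assoc mult)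
  then have ZGY: "Z * (B * diag_powr C (-1)) * Y = Sc"
    by (simp add: powC assms(9,10))

  have "let \<Sigma> = interior_diag N \<sigma>;
           V = diag_powr C (1/2) * diag_powr W (-1/2) * Q
       in invertible_mat V \<and>
          mat_inv V = transpose_mat Q * diag_powr W (1/2) * diag_powr C (-1/2) \<and>
          B * diag_powr C (-1) = V * \<Sigma> * mat_inv V \<and>
          invertible_mat \<Sigma> \<and>
          C * D2 = V * mat_inv \<Sigma> * mat_inv V"
    if "orthogonal_diagonalisation Sc Q (interior_diag N \<sigma>)" for Q \<sigma>
  proof -
    have Q: "Q \<in> carrier_mat n n" "interior_diag N \<sigma> \<in> carrier_mat n n" "transpose_mat Q * Q = 1\<^sub>m n"
      "Z * (B * diag_powr C (-1)) * Y = Q * interior_diag N \<sigma> * transpose_mat Q"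
      using that Sc ZGY by (auto simp: orthogonal_diagonalisation_def)
    have "transpose_mat Q * Z = transpose_mat Q * diag_powr W (1/2) * diag_powr C (-1/2)"
      unfolding Z_def using Q(1) dW dC by (simp add: assoc)
    then show ?thesis
      using conjugated_diagonalisation[OF YZ mult[OF B dC] mult[OF C D2] Q(1,2) YZ1 GH Q(3,4)]
      unfolding Let_def Y_def by simp
  qed
  with neg ex show ?thesis
    by blast
qed

end
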